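(* For all real $p,s,t$ with $0<p\le s\le \mathrm e^{-3}$ and $0\le t<\log(1/p)/\log(1/s)$, $$\mathbb E_{X\sim\mathrm{Bernoulli}(p)}\big[\exp(t(X-s))\big]\le\exp\left(\frac{p\,t^2}{2\left[1-t\,\log(1/s)/\log(1/p)\right]}\right).$$
   Context: $\log$ is the natural logarithm and $\mathrm e$ its base. $X\sim\mathrm{Bernoulli}(p)$ means $X\in\{0,1\}$ with $\mathbb P(X=1)=p$. *)

theory Defs
  imports "HOL-Probability.Probability"
begin

end

theory Submission
  imports Defs
begin

text \<open>
  Put \<open>r = ln (1/p) / ln (1/s)\<close>. Since \<open>1 + x \<le> exp x\<close>, it suffices to bound
  \<open>p (exp t - 1)\<close> by \<open>t s + p t\<^sup>2 / (2 (1 - t/r))\<close>, and \<open>s \<ge> p exp (3 (r - 1))\<close> because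
  \<open>ln (1/s) \<ge> 3\<close>. If \<open>r \<le> 2\<close>, then the quadratic term is at least \<open>p t\<^sup>2 / (2 - t)\<close> and the claim
  is the Pade bound \<open>exp t \<le> (2 + t) / (2 - t)\<close>. If \<open>r > 2\<close>, then
  \<open>exp t - 1 \<le> t exp t \<le> t exp (3 (r - 1))\<close>, and the quadratic term is not needed.
\<close>

text \<open>Multiply \<open>1 - t \<le> exp (- t)\<close> by \<open>exp t\<close>.\<close>

lemma exp_minus_one_le_mult_exp: "exp t - 1 \<le> t * exp t" for t :: real
proof -
  have "(1 - t) * exp t \<le> exp (- t) * exp t"
    using exp_ge_add_one_self[of "- t"] by (intro mult_right_mono) auto
  then show ?thesis
    by (simp add: algebra_simps flip: exp_add)
qed

text \<open>With the denominator cleared, the difference \<open>f\<close> vanishes at 0, and its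
  derivative is nonnegative by the previous lemma.\<close>

lemma exp_le_Pade:
  fixes t :: real
  assumes "0 \<le> t" "t < 2"
  shows "exp t \<le> (2 + t) / (2 - t)"
proof -
  define f where "f = (\<lambda>x::real. 2 + x - (2 - x) * exp x)"
  have "f 0 \<le> f t"
  proof (rule DERIV_nonneg_imp_nondecreasing[OF assms(1)])
    fix x :: real
    have "(f has_real_derivative 1 - (1 - x) * exp x) (at x)"
      unfolding f_def by (auto intro!: derivative_eq_intros simp: algebra_simps)
    moreover have "0 \<le> 1 - (1 - x) * exp x"
      using exp_minus_one_le_mult_exp[of x] by (simp add: algebra_simps)
    ultimately show "\<exists>y. (f has_real_derivative y) (at x) \<and> 0 \<le> y"
      by blast
  qed
  then show ?thesis
    using assms by (simp add: f_def field_simps)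
qed

text \<open>This is the bound on \<open>p * (exp t - 1)\<close> divided by \<open>p\<close>, with
  \<open>s / p\<close> replaced by its lower bound \<open>exp (3 * (r - 1))\<close>.\<close>

lemma exp_minus_one_le:
  fixes r t :: real
  assumes "1 \<le> r" "0 \<le> t" "t < r"
  shows "exp t - 1 \<le> t * exp (3 * (r - 1)) + t\<^sup>2 / (2 * (1 - t / r))"
proof -
  define u where "u = t / r"
  have u: "u < 1"
    using assms by (simp add: u_def)
  have "exp t - 1 \<le> t * exp (3 * (r - 1)) + t\<^sup>2 / (2 * (1 - u))"
  proof (cases "r \<le> 2")
    case True
    have "t / 2 \<le> u"
      unfolding u_def using assms True by (intro divide_left_mono) auto
    then have "t\<^sup>2 / (2 - t) \<le> t\<^sup>2 / (2 * (1 - u))"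
      using u by (intro frac_le) auto
    moreover have "t * 1 \<le> t * exp (3 * (r - 1))"
      using assms by (intro mult_left_mono) auto
    \<comment> \<open>The right-hand side equals \<open>(2 + t) / (2 - t) - 1\<close>.\<close>
    moreover have "exp t - 1 \<le> t + t\<^sup>2 / (2 - t)"
      using exp_le_Pade[of t] assms True by (simp add: field_simps power2_eq_square)
    ultimately show ?thesis by simp
  next
    case False
    have "exp t - 1 \<le> t * exp t"
      by (rule exp_minus_one_le_mult_exp)
    \<comment> \<open>Here \<open>t < r \<le> 3 * (r - 1)\<close>, as \<open>r > 2\<close>.\<close>
    also have "\<dots> \<le> t * exp (3 * (r - 1))"
      using assms False by (intro mult_left_mono) auto
    finally show ?thesis
      using u by (simp add: add_increasing2)
  qed
  then show ?thesis by (simp only: u_def)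
qed

theorem lemma1:
  fixes p s t :: real
  assumes "0 < p" and "p \<le> s" and "s \<le> exp (-3)"
    and "0 \<le> t" and "t < ln (1 / p) / ln (1 / s)"
  shows "measure_pmf.expectation (bernoulli_pmf p) (\<lambda>X. exp (t * (of_bool X - s)))
           \<le> exp (p * t\<^sup>2 / (2 * (1 - t * ln (1 / s) / ln (1 / p))))"
proof -
  define r where "r = ln (1 / p) / ln (1 / s)"
  define Q where "Q = t\<^sup>2 / (2 * (1 - t / r))"
  have s: "0 < s" using assms by simp
  have "p < 1"
    using assms by (smt (verit) exp_less_one_iff)
  have Ls: "3 \<le> ln (1 / s)"
    using assms(3) s by (simp add: ln_div ln_ge_iff) (metis exp_le_cancel_iff exp_ln le_minus_iff)
  have "ln (1 / s) \<le> ln (1 / p)"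
    using assms s by (simp add: ln_div)
  then have r: "1 \<le> r"
    using Ls by (simp add: r_def)
  have "3 * (r - 1) \<le> ln (1 / s) * (r - 1)"
    using Ls r by (intro mult_right_mono) auto
  \<comment> \<open>Since \<open>ln (1 / s) * r = ln (1 / p)\<close>, the product is a difference of
    logarithms.\<close>
  also have "\<dots> = ln (s / p)"
    using Ls s assms by (auto simp: r_def ln_div field_simps)
  finally have "exp (3 * (r - 1)) \<le> s / p"
    using s assms by (simp add: ln_ge_iff)
  then have "t * exp (3 * (r - 1)) \<le> t * (s / p)"
    using assms by (intro mult_left_mono)
  with exp_minus_one_le[of r t] r assms have "exp t - 1 \<le> t * (s / p) + Q"
    by (simp add: Q_def r_def)
  then have "p * (exp t - 1) \<le> p * (t * (s / p) + Q)"
    using assms by (intro mult_left_mono) auto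
  also have "\<dots> = t * s + p * Q"
    using assms by (simp add: algebra_simps)
  finally have exponent: "p * (exp t - 1) - t * s \<le> p * Q"
    by simp
  \<comment> \<open>The weights \<open>p\<close> and \<open>1 - p\<close> are attached to
    \<open>exp (t * (1 - s))\<close> and \<open>exp (- (t * s))\<close>; the latter is factored
    out.\<close>
  have "measure_pmf.expectation (bernoulli_pmf p) (\<lambda>X. exp (t * (of_bool X - s)))
      = (1 + p * (exp t - 1)) * exp (- (t * s))"
    using assms \<open>p < 1\<close> by (simp add: algebra_simps flip: exp_add)
  also have "\<dots> \<le> exp (p * (exp t - 1)) * exp (- (t * s))"
    by (intro mult_right_mono exp_ge_add_one_self) auto
  also have "\<dots> \<le> exp (p * Q)"
    using exponent by (simp flip: exp_add)
  finally show ?thesis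
    by (simp add: Q_def r_def)
qed

end
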